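(* Let $d\ge1$, let $\|\cdot\|$ be a norm on $\mathbb{R}^d$, let $\mathcal{X}=\{x\in\mathbb{R}^d:\|x\|\le1\}$ be its unit ball, equipped with the Lebesgue measure $\mu$ normalized so that $\mu(\mathcal{X})=1$, and let $\alpha\in(0,1]$, $p\in[1,\infty]$, $M\ge1$, $\varepsilon_1,\ldots,\varepsilon_M\ge0$. For $x^{(1)},\ldots,x^{(M)}\in\mathcal{X}$, let $$u_{\mathbf{0},\boldsymbol{\varepsilon}}(x)=\min_{1\le m\le M}\big(\varepsilon_m+\|x-x^{(m)}\|^\alpha\big),\qquad x\in\mathcal{X}.$$ Then $$\min_{1\le m\le M}(\varepsilon_m)+\frac{c}{M^{\alpha/d}}\ \le\ \inf_{x^{(1)},\ldots,x^{(M)}\in\mathcal{X}}\|u_{\mathbf{0},\boldsymbol{\varepsilon}}\|_{L_p(\mathcal{X})}\ \le\ \max_{1\le m\le M}(\varepsilon_m)+\frac{C}{M^{\alpha/d}},$$ where the absolute constants can be taken as $c=1/2$ and $C=3$.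
   Context: $L_p(\mathcal{X})$ is taken with respect to the normalized (probability) Lebesgue measure $\mu$ on $\mathcal{X}$. *)

theory Defs
  imports "HOL-Analysis.Analysis" "HOL-Probability.Essential_Supremum"
begin

text \<open>The type class \<open>real_normed_vector\<close> fixes one norm per type (the Euclidean one on
  \<open>real ^ 'n\<close>), so an arbitrary norm is a function satisfying the norm axioms.
  Nonnegativity follows from these axioms.\<close>

definition is_norm :: "('a::real_vector \<Rightarrow> real) \<Rightarrow> bool" where
  "is_norm N \<longleftrightarrow>
     (\<forall>x. N x = 0 \<longleftrightarrow> x = 0) \<and>
     (\<forall>a x. N (a *\<^sub>R x) = \<bar>a\<bar> * N x) \<and>
     (\<forall>x y. N (x + y) \<le> N x + N y)"

definition unit_ball :: "('a::real_vector \<Rightarrow> real) \<Rightarrow> 'a set" where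
  "unit_ball N = {x. N x \<le> 1}"

text \<open>The measure lives on the whole space but is concentrated on the ball, so integrals and
  essential suprema with respect to it only see the values of a function on the ball.\<close>

definition ball_measure :: "('a::euclidean_space \<Rightarrow> real) \<Rightarrow> 'a measure" where
  "ball_measure N = uniform_measure lebesgue (unit_ball N)"

text \<open>The case distinction on the integral only serves to extend the real power
  \<open>t powr (1 / p)\<close> by \<open>\<infinity> powr (1 / p) = \<infinity>\<close>.\<close>

definition Lp_norm :: "ennreal \<Rightarrow> 'a measure \<Rightarrow> ('a \<Rightarrow> real) \<Rightarrow> ennreal" where
  "Lp_norm p \<mu> f =
     (if p = \<infinity> then esssup \<mu> (\<lambda>x. ennreal \<bar>f x\<bar>)
      else let I = (\<integral>\<^sup>+ x. ennreal (\<bar>f x\<bar> powr enn2real p) \<partial>\<mu>)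
           in if I = \<infinity> then \<infinity> else ennreal (enn2real I powr (1 / enn2real p)))"

definition u_zero ::
  "('a::real_vector \<Rightarrow> real) \<Rightarrow> real \<Rightarrow> nat \<Rightarrow> (nat \<Rightarrow> real) \<Rightarrow> (nat \<Rightarrow> 'a) \<Rightarrow> 'a \<Rightarrow> real" where
  "u_zero N \<alpha> M \<epsilon> xs x = (MIN m\<in>{1..M}. \<epsilon> m + N (x - xs m) powr \<alpha>)"

end

theory Submission
  imports Defs "HOL-Probability.Probability_Measure"
begin

text \<open>Lower bound: for a probability measure the \<open>L_p\<close> norm dominates the mean. A ball of radius
  \<open>r\<close> has measure at most \<open>r ^ d\<close>, so \<open>h = min\<^sub>m M * N (x - x\<^sub>m) ^ d\<close> satisfies \<open>P(h \<le> s) \<le> s\<close>,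
  i.e. it dominates a uniform variable stochastically, and hence \<open>E min(h, 1) \<ge> 1/2\<close>. Since
  \<open>\<alpha> \<le> d\<close>, the function in question is at least \<open>min \<epsilon> + M powr (-\<alpha>/d) * min(h, 1)\<close>.
  Upper bound: by comparing volumes, an \<open>r\<close>-separated subset of the unit ball has at most
  \<open>(3/r) ^ d\<close> points if \<open>r \<le> 1\<close>, and a maximal one is an \<open>r\<close>-net; take \<open>r = 3 * M powr (-1/d)\<close>.\<close>

section \<open>The \<open>L_p\<close> norm on a probability space\<close>

text \<open>For \<open>t > 0\<close> this is convexity of the power function. The tangent argument
  runs on the open half-line, so \<open>t = 0\<close> is computed directly: the left side becomes
  \<open>(1 - q) * a powr q\<close>.\<close>

lemma powr_above_tangent:
  fixes a t q :: real
  assumes "0 < a" "0 \<le> t" "1 \<le> q"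
  shows "a powr q + q * a powr (q - 1) * (t - a) \<le> t powr q"
proof (cases "t = 0")
  case True
  have "a powr q = a powr (q - 1) * a"
    using assms by (simp add: powr_diff)
  then have "a powr q + q * a powr (q - 1) * (t - a) = (1 - q) * a powr q"
    using True by (simp add: algebra_simps)
  also have "\<dots> \<le> 0"
    using assms by (simp add: mult_nonpos_nonneg)
  finally show ?thesis
    using True by simp
next
  case False
  have "((\<lambda>x. x powr q) has_field_derivative q * a powr (q - 1)) (at a within {0<..})"
    using assms by (auto intro!: derivative_eq_intros)
  then have "t powr q - a powr q \<ge> q * a powr (q - 1) * (t - a)"
    using assms False by (intro convex_on_imp_above_tangent[OF powr_convex]) (auto simp: interior_open)
  then show ?thesis by simp
qed

text \<open>Jensen's inequality, obtained by integrating the tangent of \<open>t powr q\<close> at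
  the mean. It reduces the lower bound for every \<open>p\<close> to a bound on the mean.\<close>

lemma (in prob_space) nn_integral_le_Lp_norm:
  fixes f :: "'a \<Rightarrow> real"
  assumes f [measurable]: "f \<in> borel_measurable M" and nonneg: "\<And>x. 0 \<le> f x" and p: "1 \<le> p"
  shows "(\<integral>\<^sup>+x. ennreal (f x) \<partial>M) \<le> Lp_norm p M f"
proof (cases "p = \<infinity>")
  case True
  have "(\<integral>\<^sup>+x. ennreal (f x) \<partial>M) \<le> (\<integral>\<^sup>+x. esssup M (\<lambda>x. ennreal \<bar>f x\<bar>) \<partial>M)"
    using esssup_AE[of "\<lambda>x. ennreal \<bar>f x\<bar>" M] nonneg by (intro nn_integral_mono_AE) simp
  also have "\<dots> = esssup M (\<lambda>x. ennreal \<bar>f x\<bar>)"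
    by (simp add: emeasure_space_1)
  finally show ?thesis
    using True by (simp add: Lp_norm_def)
next
  case False
  define q where "q = enn2real p"
  have "p = ennreal q"
    using False by (simp add: q_def less_top)
  then have q: "1 \<le> q"
    using p by (metis ennreal_1 ennreal_le_iff2 not_one_le_zero zero_less_one_class.zero_le_one)
  define I where "I = (\<integral>\<^sup>+x. ennreal (f x powr q) \<partial>M)"
  have Lp: "Lp_norm p M f = (if I = \<infinity> then \<infinity> else ennreal (enn2real I powr (1 / q)))"
    using False nonneg by (simp add: Lp_norm_def I_def q_def Let_def)
  show ?thesis
  proof (cases "I = \<infinity>")
    case True
    then show ?thesis by (simp add: Lp)
  next
    case fin: False
    have intq: "integrable M (\<lambda>x. f x powr q)"
      using fin by (intro integrableI_nonneg) (auto simp: I_def less_top)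
    \<comment> \<open>This domination transfers integrability from \<open>f x powr q\<close> to
      \<open>f\<close>, so that the mean is finite.\<close>
    have bound: "f x \<le> 1 + f x powr q" for x
    proof (cases "f x \<le> 1")
      case False
      then have "f x powr 1 \<le> f x powr q"
        using q by (intro powr_mono) auto
      then show ?thesis using False by simp
    qed (simp add: add_increasing2)
    have int: "integrable M f"
    proof (rule Bochner_Integration.integrable_bound)
      show "integrable M (\<lambda>x. 1 + f x powr q)"
        by (simp add: intq)
      show "AE x in M. norm (f x) \<le> norm (1 + f x powr q)"
        using bound nonneg by (intro AE_I2) (simp add: abs_of_nonneg)
    qed simp
    define a where "a = expectation f"
    have a: "0 \<le> a"
      using nonneg by (simp add: a_def)
    have nna: "(\<integral>\<^sup>+x. ennreal (f x) \<partial>M) = ennreal a"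
      using int nonneg by (simp add: a_def nn_integral_eq_integral)
    have I: "I = ennreal (expectation (\<lambda>x. f x powr q))"
      using intq by (simp add: I_def nn_integral_eq_integral)
    have "a powr q \<le> expectation (\<lambda>x. f x powr q)"
    proof (cases "a = 0")
      case False
      \<comment> \<open>The linear term of the tangent integrates to zero because \<open>a\<close>
        is the mean of \<open>f\<close>.\<close>
      have "expectation (\<lambda>x. a powr q + q * a powr (q - 1) * (f x - a))
        \<le> expectation (\<lambda>x. f x powr q)"
        using False a q nonneg by (intro integral_mono powr_above_tangent) (auto simp: int intq)
      also have "expectation (\<lambda>x. a powr q + q * a powr (q - 1) * (f x - a)) = a powr q"
        by (simp add: int a_def[symmetric] prob_space)
      finally show ?thesis .
    qed simp
    then have "(a powr q) powr (1 / q) \<le> expectation (\<lambda>x. f x powr q) powr (1 / q)"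
      using q by (intro powr_mono2) auto
    then have "a \<le> expectation (\<lambda>x. f x powr q) powr (1 / q)"
      using q a by (simp add: powr_powr)
    then show ?thesis
      using fin by (simp add: Lp nna) (simp add: I)
  qed
qed

lemma (in prob_space) Lp_norm_le_const:
  fixes f :: "'a \<Rightarrow> real"
  assumes f [measurable]: "f \<in> borel_measurable M" and le: "AE x in M. \<bar>f x\<bar> \<le> B"
    and B: "0 \<le> B" and p: "1 \<le> p"
  shows "Lp_norm p M f \<le> ennreal B"
proof (cases "p = \<infinity>")
  case True
  have "esssup M (\<lambda>x. ennreal \<bar>f x\<bar>) \<le> ennreal B"
    using le by (intro esssup_I) (auto simp: ennreal_leI)
  then show ?thesis
    using True by (simp add: Lp_norm_def)
next
  case False
  define q where "q = enn2real p"
  have "p = ennreal q"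
    using False by (simp add: q_def less_top)
  then have q: "1 \<le> q"
    using p by (metis ennreal_1 ennreal_le_iff2 not_one_le_zero zero_less_one_class.zero_le_one)
  define I where "I = (\<integral>\<^sup>+x. ennreal (\<bar>f x\<bar> powr q) \<partial>M)"
  have "I \<le> (\<integral>\<^sup>+x. ennreal (B powr q) \<partial>M)"
    unfolding I_def using le q
    by (intro nn_integral_mono_AE) (auto intro!: ennreal_leI powr_mono2 elim!: eventually_mono)
  then have I: "I \<le> ennreal (B powr q)"
    by (simp add: emeasure_space_1)
  then have fin: "I \<noteq> \<infinity>"
    by (auto simp: top_unique)
  have "enn2real I \<le> B powr q"
    using enn2real_mono[OF I] by simp
  then have "enn2real I powr (1 / q) \<le> (B powr q) powr (1 / q)"
    using q by (intro powr_mono2) auto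
  then have "enn2real I powr (1 / q) \<le> B"
    using q B by (simp add: powr_powr)
  then show ?thesis
    using False fin by (simp add: Lp_norm_def I_def[symmetric] q_def[symmetric] ennreal_leI)
qed

text \<open>The counted integers are at most the floor of \<open>n * t\<close>, so rounding goes in
  the right direction; the cap at 1 comes from having only \<open>n\<close> candidates. This is the
  pointwise estimate behind the layer-cake argument below.\<close>

lemma card_less_multiple_le:
  fixes t :: real
  assumes "0 \<le> t"
  shows "real (card {k\<in>{1..n}. real k < real n * t}) \<le> real n * min t 1"
proof -
  have "{k\<in>{1..n}. real k < real n * t} \<subseteq> {1..nat \<lfloor>real n * t\<rfloor>}"
    using assms by (auto simp: le_nat_floor)
  then have "card {k\<in>{1..n}. real k < real n * t} \<le> nat \<lfloor>real n * t\<rfloor>"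
    using card_mono[of "{1..nat \<lfloor>real n * t\<rfloor>}"] by auto
  then have "real (card {k\<in>{1..n}. real k < real n * t}) \<le> real n * t"
    using assms by (smt (verit) mult_nonneg_nonneg of_int_floor_le of_nat_0_le_iff of_nat_le_iff of_nat_nat zero_le_floor)
  moreover have "card {k\<in>{1..n}. real k < real n * t} \<le> card {1..n}"
    by (intro card_mono) auto
  ultimately show ?thesis
    by (auto simp: min_def)
qed

text \<open>Discretised layer-cake formula: \<open>n * min (h x) 1\<close> is at least the number of
  \<open>k \<in> {1..n}\<close> with \<open>h x > k / n\<close>.\<close>

lemma (in prob_space) half_le_expectation_min_1:
  fixes h :: "'a \<Rightarrow> real"
  assumes h [measurable]: "h \<in> borel_measurable M" and nonneg: "\<And>x. 0 \<le> h x"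
    and le: "\<And>s. 0 \<le> s \<Longrightarrow> prob {x\<in>space M. h x \<le> s} \<le> s"
  shows "1 / 2 \<le> expectation (\<lambda>x. min (h x) 1)"
proof (rule LIMSEQ_le_const2)
  have [simp]: "integrable M (\<lambda>x. min (h x) 1)"
    using nonneg by (intro integrable_const_bound[where B = 1]) (auto simp: min_def)
  \<comment> \<open>Discretising with step \<open>1 / n\<close> loses \<open>1 / (2 * n)\<close>,
    which vanishes in the limit.\<close>
  show "(\<lambda>n. 1 / 2 - 1 / real n / 2) \<longlonglongrightarrow> 1 / 2"
    using tendsto_diff[OF tendsto_const tendsto_divide[OF lim_1_over_n tendsto_const[of "2::real"]],
        of "1 / 2"] by simp
  show "\<exists>n0. \<forall>n\<ge>n0. 1 / 2 - 1 / real n / 2 \<le> expectation (\<lambda>x. min (h x) 1)"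
  proof (intro exI[of _ 1] allI impI)
    fix n :: nat assume n: "1 \<le> n"
    let ?A = "\<lambda>k. {x\<in>space M. real k < real n * h x}"
    have [measurable]: "?A k \<in> events" for k
      by measurable
    have "(\<Sum>k=1..n. real k) = real n * (real n + 1) / 2"
      by (induction n) (simp_all add: field_simps)
    then have "(real n - 1) / 2 = (\<Sum>k=1..n. 1 - real k / real n)"
      using n by (simp add: sum_subtractf field_simps flip: sum_divide_distrib)
    also have "\<dots> \<le> (\<Sum>k=1..n. prob (?A k))"
    proof (rule sum_mono)
      fix k
      \<comment> \<open>The complement is a sublevel set of \<open>h\<close>, to which the
        hypothesis applies with \<open>s = k / n\<close>.\<close>
      have "prob (?A k) = 1 - prob (space M - ?A k)"
        by (subst prob_compl) auto
      also have "space M - ?A k = {x\<in>space M. h x \<le> real k / real n}"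
        using n by (auto simp: field_simps)
      finally show "1 - real k / real n \<le> prob (?A k)"
        using le[of "real k / real n"] by simp
    qed
    also have "\<dots> = expectation (\<lambda>x. \<Sum>k=1..n. indicator (?A k) x)"
      by (subst Bochner_Integration.integral_sum) (auto simp: less_top[symmetric])
    also have "\<dots> \<le> expectation (\<lambda>x. real n * min (h x) 1)"
    proof (rule integral_mono)
      fix x assume "x \<in> space M"
      then have "(\<Sum>k=1..n. indicator (?A k) x) = real (card {k\<in>{1..n}. real k < real n * h x})"
        by (simp add: indicator_def sum.If_cases Int_def)
      then show "(\<Sum>k=1..n. indicator (?A k) x) \<le> real n * min (h x) 1"
        using card_less_multiple_le[OF nonneg] by simp
    qed (auto simp: less_top[symmetric])
    finally show "1 / 2 - 1 / real n / 2 \<le> expectation (\<lambda>x. min (h x) 1)"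
      using n by (simp add: field_simps)
  qed
qed

section \<open>Balls of an arbitrary norm\<close>

lemma is_normD:
  assumes "is_norm N"
  shows "N 0 = 0" "N x = 0 \<longleftrightarrow> x = 0" "N (a *\<^sub>R x) = \<bar>a\<bar> * N x" "N (x + y) \<le> N x + N y"
    "N (- x) = N x" "N (x - y) = N (y - x)" "0 \<le> N x"
proof -
  show N: "N 0 = 0" "N x = 0 \<longleftrightarrow> x = 0" "\<And>a x. N (a *\<^sub>R x) = \<bar>a\<bar> * N x"
      "\<And>x y. N (x + y) \<le> N x + N y"
    using assms by (auto simp: is_norm_def)
  show minus: "N (- x) = N x" for x
    using N(3)[of "-1" x] by simp
  show "N (x - y) = N (y - x)"
    using minus[of "x - y"] by simp
  show "0 \<le> N x"
    using N(4)[of x "- x"] minus N(1) by simp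
qed

lemma is_norm_triangle_dist:
  assumes "is_norm N"
  shows "N (x - z) \<le> N (x - y) + N (y - z)"
  using is_normD(4)[OF assms, of "x - y" "y - z"] by simp

context
  fixes N :: "'a::euclidean_space \<Rightarrow> real"
  assumes N: "is_norm N"
begin

text \<open>Homogeneity and the triangle inequality make \<open>N\<close> convex, and a convex
  function on a finite-dimensional space is continuous.\<close>

lemma continuous_on_is_norm: "continuous_on UNIV N"
proof (rule convex_on_continuous)
  show "convex_on UNIV N"
  proof (rule convex_onI)
    fix t :: real and x y :: 'a assume "0 < t" "t < 1"
    then show "N ((1 - t) *\<^sub>R x + t *\<^sub>R y) \<le> (1 - t) * N x + t * N y"
      using is_normD(4)[OF N, of "(1 - t) *\<^sub>R x" "t *\<^sub>R y"] by (simp add: is_normD(3)[OF N])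
  qed simp
qed simp

lemma borel_measurable_is_norm [measurable]: "N \<in> borel_measurable borel"
  using continuous_on_is_norm by (rule borel_measurable_continuous_onI)

text \<open>The constant is the minimum of \<open>N\<close> on the compact Euclidean unit sphere,
  positive by definiteness; scaling does the rest. This makes the unit ball of \<open>N\<close>
  bounded.\<close>

lemma is_norm_lower_bound: "\<exists>c>0. \<forall>x. c * norm x \<le> N x"
proof -
  obtain b :: 'a where b: "b \<in> Basis"
    using nonempty_Basis by blast
  then have "sphere (0::'a) 1 \<noteq> {}"
    by (auto intro!: exI[of _ b])
  then obtain z where z: "z \<in> sphere 0 1" "\<And>y. y \<in> sphere 0 1 \<Longrightarrow> N z \<le> N y"
    using continuous_attains_inf[of "sphere 0 1" N] continuous_on_subset[OF continuous_on_is_norm]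
    by auto
  have "N z > 0"
    using z(1) is_normD(2,7)[OF N, of z] by (auto simp: order.strict_iff_order)
  moreover have "N z * norm x \<le> N x" for x
  proof (cases "x = 0")
    case False
    then have "N z \<le> N ((1 / norm x) *\<^sub>R x)"
      by (intro z) simp
    then show ?thesis
      using False by (simp add: is_normD(3)[OF N] field_simps)
  qed (simp add: is_normD(1)[OF N])
  ultimately show ?thesis by blast
qed

lemma compact_unit_ball: "compact (unit_ball N)"
proof -
  obtain c where c: "c > 0" "\<And>x. c * norm x \<le> N x"
    using is_norm_lower_bound by blast
  have "norm x \<le> 1 / c" if "x \<in> unit_ball N" for x
    using c(2)[of x] c(1) that by (simp add: unit_ball_def field_simps)
  then have "bounded (unit_ball N)"
    by (auto simp: bounded_iff)
  moreover have "closed (unit_ball N)"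
    unfolding unit_ball_def using continuous_on_is_norm by (intro closed_Collect_le) auto
  ultimately show ?thesis
    by (simp add: compact_eq_bounded_closed)
qed

lemma lmeasurable_unit_ball: "unit_ball N \<in> lmeasurable"
  using compact_unit_ball by (rule lmeasurable_compact)

text \<open>By continuity the unit ball contains a Euclidean ball around 0. Positivity of the volume
  is what allows normalising by it.\<close>

lemma measure_unit_ball_pos: "0 < measure lebesgue (unit_ball N)"
proof -
  have "open {x. N x < 1}"
    using continuous_on_is_norm by (intro open_Collect_less) auto
  moreover have "0 \<in> {x. N x < 1}"
    by (simp add: is_normD(1)[OF N])
  ultimately obtain e where e: "0 < e" "ball 0 e \<subseteq> {x. N x < 1}"
    by (auto simp: open_contains_ball)
  have "0 < measure lebesgue (ball (0::'a) e)"
    using e(1) by (simp add: content_ball_pos)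
  also have "\<dots> \<le> measure lebesgue (unit_ball N)"
    using e(2) lmeasurable_unit_ball
    by (intro measure_mono_fmeasurable) (auto simp: unit_ball_def)
  finally show ?thesis .
qed

lemma is_norm_ball_eq_image:
  assumes "0 < r"
  shows "{x. N (x - c) \<le> r} = (\<lambda>x. r *\<^sub>R x + c) ` unit_ball N"
proof (intro equalityI subsetI)
  fix x assume "x \<in> {x. N (x - c) \<le> r}"
  then have "(1 / r) *\<^sub>R (x - c) \<in> unit_ball N"
    using assms by (simp add: unit_ball_def is_normD(3)[OF N] del: scaleR_right_diff_distrib)
  moreover have "x = r *\<^sub>R ((1 / r) *\<^sub>R (x - c)) + c"
    using assms by simp
  ultimately show "x \<in> (\<lambda>x. r *\<^sub>R x + c) ` unit_ball N"
    by blast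
qed (use assms in \<open>auto simp: unit_ball_def is_normD(3)[OF N] mult_left_le\<close>)

lemma lmeasurable_is_norm_ball: "{x. N (x - c) \<le> r} \<in> lmeasurable"
proof -
  \<comment> \<open>The radius is arbitrary here, while the image description needs a positive one;
    \<open>\<bar>r\<bar> + 1\<close> is positive and at least \<open>r\<close>.\<close>
  have "compact {x. N (x - c) \<le> \<bar>r\<bar> + 1}"
    using compact_unit_ball
    by (subst is_norm_ball_eq_image) (auto intro!: compact_continuous_image continuous_intros)
  moreover have "closed {x. N (x - c) \<le> r}"
    by (intro closed_Collect_le continuous_on_compose2[OF continuous_on_is_norm] continuous_intros) auto
  moreover have "{x. N (x - c) \<le> r} = {x. N (x - c) \<le> \<bar>r\<bar> + 1} \<inter> {x. N (x - c) \<le> r}"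
    by auto
  ultimately show ?thesis
    by (metis compact_Int_closed lmeasurable_compact)
qed

lemma measure_is_norm_ball:
  assumes "0 \<le> r"
  shows "measure lebesgue {x. N (x - c) \<le> r} = r ^ DIM('a) * measure lebesgue (unit_ball N)"
proof (cases "r = 0")
  case True
  \<comment> \<open>At radius 0 the ball is a point, hence null, and \<open>0 ^ DIM('a) = 0\<close>
    since the dimension is positive.\<close>
  have "N (x - c) \<le> 0 \<longleftrightarrow> x = c" for x
    using is_normD(2,7)[OF N, of "x - c"] by auto
  then have "{x. N (x - c) \<le> r} = {c}"
    by (simp add: True)
  then show ?thesis
    using True by (simp add: measure_def)
next
  case False
  then show ?thesis
    using assms measure_lebesgue_affine[of r c "unit_ball N"] by (simp add: is_norm_ball_eq_image)
qed

section \<open>The normalised measure on the unit ball\<close>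

lemma prob_space_ball_measure: "prob_space (ball_measure N)"
  unfolding ball_measure_def using measure_unit_ball_pos lmeasurable_unit_ball
  by (intro prob_space_uniform_measure) (auto simp: fmeasurable_def measure_def less_top)

lemma AE_ball_measure: "AE x in ball_measure N. x \<in> unit_ball N"
  unfolding ball_measure_def using lmeasurable_unit_ball
  by (intro AE_uniform_measureI) auto

lemma space_ball_measure: "space (ball_measure N) = UNIV"
  by (simp add: ball_measure_def)

lemma borel_measurable_ball_measureI:
  "f \<in> borel_measurable borel \<Longrightarrow> f \<in> borel_measurable (ball_measure N)"
  unfolding ball_measure_def measurable_cong_sets[OF sets_uniform_measure refl]
  by (intro measurable_completion) simp

text \<open>Dropping the intersection with the unit ball only increases the volume, so any centre
  \<open>c\<close> is allowed; the normalising factor then cancels.\<close>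

lemma measure_ball_measure_le:
  assumes "0 \<le> r"
  shows "measure (ball_measure N) {x. N (x - c) \<le> r} \<le> r ^ DIM('a)"
proof -
  have [measurable]: "{x. N (x - c) \<le> r} \<in> sets lebesgue"
    using lmeasurable_is_norm_ball by auto
  have "measure (ball_measure N) {x. N (x - c) \<le> r}
    = measure lebesgue (unit_ball N \<inter> {x. N (x - c) \<le> r}) / measure lebesgue (unit_ball N)"
    unfolding ball_measure_def using measure_unit_ball_pos lmeasurable_unit_ball
    by (intro measure_uniform_measure) (auto simp: fmeasurable_def measure_def less_top)
  also have "\<dots> \<le> measure lebesgue {x. N (x - c) \<le> r} / measure lebesgue (unit_ball N)"
    using lmeasurable_unit_ball lmeasurable_is_norm_ball
    by (intro divide_right_mono measure_mono_fmeasurable) auto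
  also have "\<dots> = r ^ DIM('a)"
    using measure_unit_ball_pos by (simp only: measure_is_norm_ball[OF assms]) simp
  finally show ?thesis .
qed

section \<open>Packing and nets\<close>

text \<open>The balls of radius \<open>r / 2\<close> around the points of \<open>S\<close> are
  disjoint and lie in the ball of radius \<open>3 / 2\<close>, since
  \<open>1 + r / 2 \<le> 3 / 2\<close>. Comparing volumes gives the ratio
  \<open>(3 / r) ^ d\<close>.\<close>

lemma card_separated_le:
  assumes S: "finite S" "S \<subseteq> unit_ball N" and r: "0 < r" "r \<le> 1"
    and sep: "\<And>x y. x \<in> S \<Longrightarrow> y \<in> S \<Longrightarrow> x \<noteq> y \<Longrightarrow> r < N (x - y)"
  shows "real (card S) \<le> (3 / r) ^ DIM('a)"
proof -
  let ?B = "\<lambda>s. {x. N (x - s) \<le> r / 2}" and ?V = "measure lebesgue (unit_ball N)"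
  have "disjoint_family_on ?B S"
    unfolding disjoint_family_on_def
  proof (intro ballI impI equals0I)
    fix s t x assume *: "s \<in> S" "t \<in> S" "s \<noteq> t" "x \<in> ?B s \<inter> ?B t"
    then have "N (s - t) \<le> r"
      using is_norm_triangle_dist[OF N, of s t x] is_normD(6)[OF N, of s x] by simp
    then show False
      using sep[of s t] * by simp
  qed
  then have "measure lebesgue (\<Union>s\<in>S. ?B s) = (\<Sum>s\<in>S. measure lebesgue (?B s))"
    using S lmeasurable_is_norm_ball
    by (intro measure_finite_Union)
      (force simp: fmeasurable_def less_top[symmetric] simp del: le_divide_eq_numeral1)+
  also have "\<dots> = real (card S) * (r / 2) ^ DIM('a) * ?V"
    using r measure_is_norm_ball[of "r / 2"] by (simp only:) simp
  finally have "real (card S) * (r / 2) ^ DIM('a) * ?V = measure lebesgue (\<Union>s\<in>S. ?B s)" ..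
  also have "\<dots> \<le> measure lebesgue {x. N (x - 0) \<le> 3 / 2}"
  proof (rule measure_mono_fmeasurable)
    have "N x \<le> 3 / 2" if "s \<in> S" "N (x - s) \<le> r / 2" for x s
      using that S(2) r is_norm_triangle_dist[OF N, of x 0 s] by (auto simp: unit_ball_def)
    then show "(\<Union>s\<in>S. ?B s) \<subseteq> {x. N (x - 0) \<le> 3 / 2}"
      by auto
    show "(\<Union>s\<in>S. ?B s) \<in> sets lebesgue"
      using S lmeasurable_is_norm_ball by (intro sets.finite_UN) auto
  qed (rule lmeasurable_is_norm_ball)
  also have "\<dots> = (3 / 2) ^ DIM('a) * ?V"
    by (subst measure_is_norm_ball) auto
  finally have "real (card S) * (r / 2) ^ DIM('a) \<le> (3 / 2) ^ DIM('a)"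
    using measure_unit_ball_pos by simp
  then show ?thesis
    using r by (simp add: field_simps power_divide)
qed

text \<open>A separated set of greatest cardinality is a net, because an uncovered point could be
  added to it; the packing bound keeps its size within \<open>M\<close>.\<close>

lemma ex_net:
  assumes r: "0 < r" and M: "1 \<le> M" "(3 / r) ^ DIM('a) \<le> real M"
  shows "\<exists>xs\<in>{1..M} \<rightarrow> unit_ball N. \<forall>x\<in>unit_ball N. \<exists>m\<in>{1..M}. N (x - xs m) \<le> r"
proof (cases "1 \<le> r")
  case True
  \<comment> \<open>For \<open>r \<ge> 1\<close> the origin alone covers the unit ball.\<close>
  then show ?thesis
    using M by (intro bexI[of _ "\<lambda>_. 0"] ballI bexI[of _ 1]) (auto simp: unit_ball_def is_normD(1)[OF N])
next
  case False
  define P where "P S \<longleftrightarrow> finite S \<and> S \<subseteq> unit_ball N \<and> (\<forall>x\<in>S. \<forall>y\<in>S. x \<noteq> y \<longrightarrow> r < N (x - y))" for S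
  have card_le: "card S \<le> M" if "P S" for S
    using that card_separated_le[of S r] False r M by (simp add: P_def)
  have "P {}"
    by (simp add: P_def)
  then obtain S where S: "P S" "\<And>T. P T \<Longrightarrow> card T \<le> card S"
    using ex_has_greatest_nat[of P "{}" card "Suc M"] card_le by (auto simp: less_Suc_eq_le)
  have net: "\<exists>s\<in>S. N (x - s) \<le> r" if x: "x \<in> unit_ball N" for x
  proof (rule ccontr)
    assume "\<not> ?thesis"
    then have far: "\<And>s. s \<in> S \<Longrightarrow> r < N (x - s)"
      by auto
    then have "x \<notin> S"
      using r is_normD(1)[OF N] by force
    moreover have "P (insert x S)"
      using S(1) x far is_normD(6)[OF N] by (auto simp: P_def)
    ultimately show False
      using S(2)[of "insert x S"] S(1) by (simp add: P_def)
  qed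
  obtain f where f: "bij_betw f {0..<card S} S"
    using ex_bij_betw_nat_finite[of S] S(1) by (auto simp: P_def)
  \<comment> \<open>\<open>f\<close> enumerates from 0 but the indices of \<open>xs\<close> start at
    1. If \<open>S\<close> has fewer than \<open>M\<close> points, the surplus indices get the
    origin, which lies in the unit ball.\<close>
  define xs where "xs m = (if m - 1 < card S then f (m - 1) else 0)" for m
  have "f m \<in> unit_ball N" if "m < card S" for m
    using f S(1) that by (auto simp: P_def bij_betw_def)
  then have "xs \<in> {1..M} \<rightarrow> unit_ball N"
    by (auto simp: xs_def unit_ball_def is_normD(1)[OF N])
  moreover have "\<exists>m\<in>{1..M}. N (x - xs m) \<le> r" if x: "x \<in> unit_ball N" for x
  proof -
    obtain s where s: "s \<in> S" "N (x - s) \<le> r"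
      using net[OF x] by blast
    then obtain k where k: "k < card S" "f k = s"
      using f by (auto simp: bij_betw_def) (metis atLeastLessThan_iff imageE)
    show ?thesis
      using s k card_le[OF S(1)] by (intro bexI[of _ "Suc k"]) (auto simp: xs_def)
  qed
  ultimately show ?thesis by blast
qed

section \<open>Bounds for \<open>u_zero\<close>\<close>

lemma borel_measurable_u_zero: "u_zero N \<alpha> M \<epsilon> xs \<in> borel_measurable borel"
proof -
  have [measurable]: "(\<lambda>x. N (x - c)) \<in> borel_measurable borel" for c
    using measurable_compose[OF _ borel_measurable_is_norm, of "\<lambda>x. x - c"] by simp
  show ?thesis
    unfolding u_zero_def[abs_def] by measurable
qed

lemma u_zero_nonneg:
  assumes "1 \<le> M" "\<And>m. m \<in> {1..M} \<Longrightarrow> 0 \<le> \<epsilon> m"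
  shows "0 \<le> u_zero N \<alpha> M \<epsilon> xs x"
  using assms by (auto simp: u_zero_def intro!: Min.boundedI add_nonneg_nonneg)

lemma u_zero_lower_bound:
  assumes \<alpha>: "0 < \<alpha>" "\<alpha> \<le> 1" and M: "1 \<le> M" and \<epsilon>: "\<And>m. m \<in> {1..M} \<Longrightarrow> 0 \<le> \<epsilon> m" and p: "1 \<le> p"
  shows "ennreal ((MIN m\<in>{1..M}. \<epsilon> m) + (1 / 2) / real M powr (\<alpha> / real DIM('a)))
    \<le> Lp_norm p (ball_measure N) (u_zero N \<alpha> M \<epsilon> xs)"
proof -
  interpret prob_space "ball_measure N"
    by (rule prob_space_ball_measure)
  define d where "d = DIM('a)"
  have d: "1 \<le> d"
    using DIM_positive[where 'a = 'a] by (simp add: d_def)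
  define h where "h x = (MIN m\<in>{1..M}. real M * N (x - xs m) ^ d)" for x
  define E where "E = (MIN m\<in>{1..M}. \<epsilon> m)"
  define T where "T = 1 / real M powr (\<alpha> / real d)"
  have [measurable]: "(\<lambda>x. N (x - c)) \<in> borel_measurable borel" for c
    using measurable_compose[OF _ borel_measurable_is_norm, of "\<lambda>x. x - c"] by simp
  have [measurable]: "h \<in> borel_measurable borel"
    unfolding h_def by measurable
  have h_meas: "h \<in> borel_measurable (ball_measure N)"
    by (rule borel_measurable_ball_measureI) measurable
  have h_nonneg: "0 \<le> h x" for x
    using M is_normD(7)[OF N] by (auto simp: h_def intro!: Min.boundedI)
  have "prob {x. h x \<le> s} \<le> s" if s: "0 \<le> s" for s
  proof -
    \<comment> \<open>Each of the \<open>M\<close> balls of this radius has measure at most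
      \<open>r ^ d = s / M\<close>, so the union bound gives exactly \<open>s\<close>.\<close>
    define r where "r = root d (s / real M)"
    have r: "0 \<le> r" "r ^ d = s / real M"
      using s d by (simp_all add: r_def)
    have "N (x - xs m) \<le> r" if "real M * N (x - xs m) ^ d \<le> s" for x m
    proof -
      have "N (x - xs m) ^ d \<le> r ^ d"
        using that M by (simp add: r field_simps)
      then show ?thesis
        using r(1) d by (simp add: power_mono_iff is_normD(7)[OF N])
    qed
    then have "{x. h x \<le> s} \<subseteq> (\<Union>m\<in>{1..M}. {x. N (x - xs m) \<le> r})"
      using M by (auto simp: h_def Min_le_iff)
    moreover have ev: "{x. N (x - xs m) \<le> r} \<in> events" for m
      by (simp add: ball_measure_def)
    ultimately have "prob {x. h x \<le> s} \<le> prob (\<Union>m\<in>{1..M}. {x. N (x - xs m) \<le> r})"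
      by (intro finite_measure_mono) auto
    also have "\<dots> \<le> (\<Sum>m\<in>{1..M}. prob {x. N (x - xs m) \<le> r})"
      using ev by (intro finite_measure_subadditive_finite) auto
    also have "\<dots> \<le> (\<Sum>m\<in>{1..M}. s / real M)"
      using measure_ball_measure_le[OF r(1)] r(2) by (intro sum_mono) (simp add: d_def)
    also have "\<dots> = s"
      using M by simp
    finally show ?thesis .
  qed
  then have half: "1 / 2 \<le> expectation (\<lambda>x. min (h x) 1)"
    using h_nonneg by (intro half_le_expectation_min_1[OF h_meas]) (auto simp: space_ball_measure)
  have E: "0 \<le> E"
    using M \<epsilon> by (auto simp: E_def intro!: Min.boundedI)
  have T: "0 \<le> T"
    by (simp add: T_def)
  have u_ge: "E + T * min (h x) 1 \<le> u_zero N \<alpha> M \<epsilon> xs x" for x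
  proof -
    obtain m where m: "m \<in> {1..M}" "u_zero N \<alpha> M \<epsilon> xs x = \<epsilon> m + N (x - xs m) powr \<alpha>"
      using Min_in[of "(\<lambda>m. \<epsilon> m + N (x - xs m) powr \<alpha>) ` {1..M}"] M
      by (fastforce simp: u_zero_def)
    let ?n = "N (x - xs m)" and ?t = "min (h x) 1"
    have t: "0 \<le> ?t" "?t \<le> 1" "?t \<le> real M * ?n ^ d"
      using h_nonneg m(1) by (auto simp: h_def intro!: min.coboundedI1 Min_le)
    \<comment> \<open>Lowering the exponent to \<open>\<alpha> / d \<le> 1\<close> increases a power
      of a number in \<open>[0, 1]\<close>; this is why \<open>h\<close> is truncated at 1.\<close>
    have "?t powr 1 \<le> ?t powr (\<alpha> / real d)"
      using t \<alpha> d by (intro powr_mono') (auto simp: field_simps)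
    also have "\<dots> \<le> (real M * ?n ^ d) powr (\<alpha> / real d)"
      using t \<alpha> by (intro powr_mono2) auto
    also have "\<dots> = real M powr (\<alpha> / real d) * ?n powr \<alpha>"
      using d is_normD(7)[OF N, of "x - xs m"]
      by (simp add: powr_mult powr_powr flip: powr_realpow')
    finally have "T * ?t \<le> ?n powr \<alpha>"
      using M t by (simp add: T_def field_simps)
    moreover have "E \<le> \<epsilon> m"
      using m(1) by (simp add: E_def)
    ultimately show ?thesis
      using m(2) by simp
  qed
  have [simp]: "integrable (ball_measure N) (\<lambda>x. min (h x) 1)"
    using h_nonneg h_meas by (intro integrable_const_bound[where B = 1]) (auto simp: min_def)
  \<comment> \<open>The constant 1/2 is the lower bound for the mean of the truncated
    \<open>h\<close>.\<close>
  have "E + T / 2 \<le> E + T * expectation (\<lambda>x. min (h x) 1)"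
    using mult_left_mono[OF half T] by simp
  also have "\<dots> = expectation (\<lambda>x. E + T * min (h x) 1)"
    by (simp add: prob_space)
  finally have "ennreal (E + T / 2) \<le> ennreal (expectation (\<lambda>x. E + T * min (h x) 1))"
    by (rule ennreal_leI)
  also have "\<dots> = (\<integral>\<^sup>+x. ennreal (E + T * min (h x) 1) \<partial>ball_measure N)"
    using E T h_nonneg by (intro nn_integral_eq_integral[symmetric]) auto
  also have "\<dots> \<le> (\<integral>\<^sup>+x. ennreal (u_zero N \<alpha> M \<epsilon> xs x) \<partial>ball_measure N)"
    by (intro nn_integral_mono ennreal_leI u_ge)
  also have "\<dots> \<le> Lp_norm p (ball_measure N) (u_zero N \<alpha> M \<epsilon> xs)"
    using M \<epsilon> p
    by (intro nn_integral_le_Lp_norm borel_measurable_ball_measureI borel_measurable_u_zero u_zero_nonneg)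
  finally show ?thesis
    by (simp add: E_def T_def d_def mult.commute)
qed

lemma u_zero_upper_bound:
  assumes \<alpha>: "0 < \<alpha>" "\<alpha> \<le> 1" and M: "1 \<le> M" and \<epsilon>: "\<And>m. m \<in> {1..M} \<Longrightarrow> 0 \<le> \<epsilon> m" and p: "1 \<le> p"
  shows "\<exists>xs\<in>{1..M} \<rightarrow> unit_ball N. Lp_norm p (ball_measure N) (u_zero N \<alpha> M \<epsilon> xs)
    \<le> ennreal ((MAX m\<in>{1..M}. \<epsilon> m) + 3 / real M powr (\<alpha> / real DIM('a)))"
proof -
  interpret prob_space "ball_measure N"
    by (rule prob_space_ball_measure)
  define d where "d = DIM('a)"
  have d: "1 \<le> d"
    using DIM_positive[where 'a = 'a] by (simp add: d_def)
  define B where "B = (MAX m\<in>{1..M}. \<epsilon> m) + 3 / real M powr (\<alpha> / real d)"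
  \<comment> \<open>This radius solves \<open>(3 / r) ^ d = M\<close>, the size condition for the
    net. It may exceed 1 for small \<open>M\<close>, which \<open>ex_net\<close> permits.\<close>
  define r where "r = 3 / real M powr (1 / real d)"
  have r: "0 < r"
    using M by (simp add: r_def)
  have "(3 / r) ^ d = real M"
    using M d by (simp add: r_def powr_powr flip: powr_realpow)
  then obtain xs where xs: "xs \<in> {1..M} \<rightarrow> unit_ball N"
      "\<And>x. x \<in> unit_ball N \<Longrightarrow> \<exists>m\<in>{1..M}. N (x - xs m) \<le> r"
    using ex_net[OF r M] by (auto simp: d_def)
  have "r powr \<alpha> = 3 powr \<alpha> / real M powr (\<alpha> / real d)"
    using M by (simp add: r_def powr_divide powr_powr)
  \<comment> \<open>The constant 3 arises from \<open>3 powr \<alpha> \<le> 3\<close>, as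
    \<open>\<alpha> \<le> 1\<close>.\<close>
  also have "\<dots> \<le> 3 / real M powr (\<alpha> / real d)"
    using \<alpha> powr_mono[of \<alpha> 1 3] by (intro divide_right_mono) auto
  finally have r\<alpha>: "r powr \<alpha> \<le> 3 / real M powr (\<alpha> / real d)" .
  have le: "u_zero N \<alpha> M \<epsilon> xs x \<le> B" if x: "x \<in> unit_ball N" for x
  proof -
    obtain m where m: "m \<in> {1..M}" "N (x - xs m) \<le> r"
      using xs(2)[OF x] by blast
    have "u_zero N \<alpha> M \<epsilon> xs x \<le> \<epsilon> m + N (x - xs m) powr \<alpha>"
      unfolding u_zero_def using m(1) by (intro Min_le) auto
    also have "\<dots> \<le> (MAX m\<in>{1..M}. \<epsilon> m) + r powr \<alpha>"
      using m \<alpha> is_normD(7)[OF N] by (intro add_mono powr_mono2 Max_ge) auto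
    finally show ?thesis
      using r\<alpha> by (simp add: B_def)
  qed
  have nonneg: "0 \<le> u_zero N \<alpha> M \<epsilon> xs x" for x
    by (rule u_zero_nonneg[OF M \<epsilon>])
  \<comment> \<open>The origin lies in the unit ball, where \<open>B\<close> dominates a nonnegative
    function.\<close>
  have "0 \<le> B"
    using le[of 0] nonneg[of 0] by (simp add: unit_ball_def is_normD(1)[OF N])
  moreover have "AE x in ball_measure N. \<bar>u_zero N \<alpha> M \<epsilon> xs x\<bar> \<le> B"
    using AE_ball_measure by eventually_elim (use le nonneg in auto)
  ultimately have "Lp_norm p (ball_measure N) (u_zero N \<alpha> M \<epsilon> xs) \<le> ennreal B"
    using p by (intro Lp_norm_le_const borel_measurable_ball_measureI borel_measurable_u_zero)
  then show ?thesis
    using xs(1) by (auto simp: B_def d_def)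
qed

end

theorem theorem6:
  fixes N :: "real ^ 'n \<Rightarrow> real"
    and \<alpha> :: real and p :: ennreal and M :: nat and \<epsilon> :: "nat \<Rightarrow> real"
  assumes "is_norm N"
    and "0 < \<alpha>" and "\<alpha> \<le> 1"
    and "1 \<le> p"
    and "1 \<le> M"
    and "\<And>m. m \<in> {1..M} \<Longrightarrow> 0 \<le> \<epsilon> m"
  shows "ennreal ((MIN m\<in>{1..M}. \<epsilon> m) + (1 / 2) / real M powr (\<alpha> / real CARD('n)))
           \<le> (INF xs\<in>{1..M} \<rightarrow> unit_ball N. Lp_norm p (ball_measure N) (u_zero N \<alpha> M \<epsilon> xs))
       \<and> (INF xs\<in>{1..M} \<rightarrow> unit_ball N. Lp_norm p (ball_measure N) (u_zero N \<alpha> M \<epsilon> xs))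
           \<le> ennreal ((MAX m\<in>{1..M}. \<epsilon> m) + 3 / real M powr (\<alpha> / real CARD('n)))"
proof
  have "ennreal ((MIN m\<in>{1..M}. \<epsilon> m) + (1 / 2) / real M powr (\<alpha> / real CARD('n)))
      \<le> Lp_norm p (ball_measure N) (u_zero N \<alpha> M \<epsilon> xs)" for xs
    using u_zero_lower_bound[OF assms(1-3,5,6,4), where xs = xs] by simp
  then show "ennreal ((MIN m\<in>{1..M}. \<epsilon> m) + (1 / 2) / real M powr (\<alpha> / real CARD('n)))
      \<le> (INF xs\<in>{1..M} \<rightarrow> unit_ball N. Lp_norm p (ball_measure N) (u_zero N \<alpha> M \<epsilon> xs))"
    by (intro INF_greatest)
  obtain xs where "xs \<in> {1..M} \<rightarrow> unit_ball N"
      "Lp_norm p (ball_measure N) (u_zero N \<alpha> M \<epsilon> xs)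
        \<le> ennreal ((MAX m\<in>{1..M}. \<epsilon> m) + 3 / real M powr (\<alpha> / real CARD('n)))"
    using u_zero_upper_bound[OF assms(1-3,5,6,4), of "\<lambda>m. m"] by auto
  then show "(INF xs\<in>{1..M} \<rightarrow> unit_ball N. Lp_norm p (ball_measure N) (u_zero N \<alpha> M \<epsilon> xs))
      \<le> ennreal ((MAX m\<in>{1..M}. \<epsilon> m) + 3 / real M powr (\<alpha> / real CARD('n)))"
    by (intro INF_lower2)
qed

end
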